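(* Let $T$ be the $\aleph_0$-regular tree and let $1<p\leqslant\infty$. The commutant of $\lambda\big(\mathrm{Aut}(T)\big)$ in the space of linear operators from $\ell_p(T)$ to $\mathbb C^T$ is just $\mathbb C\cdot \mathrm{Id}$; that is, a (not necessarily continuous) linear operator $S\colon \ell_p(T)\to\mathbb C^T$ satisfies $S\lambda(g)=\lambda(g)S$ for all $g\in\mathrm{Aut}(T)$ if and only if there is $\alpha\in\mathbb C$ with $Sx=\alpha x$ for all $x\in\ell_p(T)$.
   Context: The $\aleph_0$-regular tree $T$ is the countable tree (connected, acyclic simple graph) in which every vertex has infinitely many neighbours; $T$ also denotes its vertex set, and $\mathrm{Aut}(T)$ is its group of graph automorphisms. $\mathbb C^T$ is the vector space of all functions $T\to\mathbb C$, and $\lambda$ is the action of $\mathrm{Aut}(T)$ on $\mathbb C^T$ by $\lambda(g)(x)=x(g^{-1}\,\cdot\,)$. The subspaces $\ell_p(T)\subseteq\mathbb C^T$ are $\lambda$-invariant. *)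

theory Defs
  imports "HOL-Analysis.Analysis"
begin

(* A graph is given by its adjacency relation; its vertex set is the whole type 'v, so that
   C^T is the function type 'v => complex. *)

definition simple_graph :: "('v \<Rightarrow> 'v \<Rightarrow> bool) \<Rightarrow> bool" where
  "simple_graph E \<longleftrightarrow> symp E \<and> irreflp E"

definition connected_graph :: "('v \<Rightarrow> 'v \<Rightarrow> bool) \<Rightarrow> bool" where
  "connected_graph E \<longleftrightarrow> (\<forall>u v. E\<^sup>*\<^sup>* u v)"

(* The length bound excludes the closed walks u, v, u that run back along a single edge. *)
definition graph_cycle :: "('v \<Rightarrow> 'v \<Rightarrow> bool) \<Rightarrow> 'v list \<Rightarrow> bool" where
  "graph_cycle E vs \<longleftrightarrow>
     length vs \<ge> 3 \<and> distinct vs \<and> successively E vs \<and> E (last vs) (hd vs)"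

definition acyclic_graph :: "('v \<Rightarrow> 'v \<Rightarrow> bool) \<Rightarrow> bool" where
  "acyclic_graph E \<longleftrightarrow> (\<nexists>vs. graph_cycle E vs)"

definition aleph0_regular_tree :: "('v \<Rightarrow> 'v \<Rightarrow> bool) \<Rightarrow> bool" where
  "aleph0_regular_tree E \<longleftrightarrow>
     countable (UNIV :: 'v set) \<and> simple_graph E \<and> connected_graph E \<and> acyclic_graph E \<and>
     (\<forall>v. infinite {w. E v w})"

definition graph_Aut :: "('v \<Rightarrow> 'v \<Rightarrow> bool) \<Rightarrow> ('v \<Rightarrow> 'v) set" where
  "graph_Aut E = {g. bij g \<and> (\<forall>u v. E (g u) (g v) \<longleftrightarrow> E u v)}"

definition translation :: "('v \<Rightarrow> 'v) \<Rightarrow> ('v \<Rightarrow> complex) \<Rightarrow> ('v \<Rightarrow> complex)" where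
  "translation g x = (\<lambda>t. x (inv g t))"

(* Intended for 0 < p \<le> \<infinity>. *)
definition ell :: "ereal \<Rightarrow> ('v \<Rightarrow> complex) set" where
  "ell p = (if p = \<infinity> then {x. bounded (range x)}
            else {x. (\<lambda>t. norm (x t) powr real_of_ereal p) summable_on UNIV})"

(* Complex linearity for the pointwise operations on a linear subspace X of C^T;
   the values of S outside X are irrelevant. *)
definition linear_operator_on ::
    "('v \<Rightarrow> complex) set \<Rightarrow> (('v \<Rightarrow> complex) \<Rightarrow> ('v \<Rightarrow> complex)) \<Rightarrow> bool" where
  "linear_operator_on X S \<longleftrightarrow>
     (\<forall>x\<in>X. \<forall>y\<in>X. S (\<lambda>t. x t + y t) = (\<lambda>t. S x t + S y t)) \<and>
     (\<forall>c. \<forall>x\<in>X. S (\<lambda>t. c * x t) = (\<lambda>t. c * S x t))"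

end

theory Submission
  imports Defs
begin

text \<open>
  Suppose \<open>S\<close> commutes with the automorphisms, and fix a vertex \<open>r\<close>. The functional \<open>x \<mapsto> S x r\<close> on
  \<open>\<ell>\<^sub>p\<close> is invariant under the stabilizer of \<open>r\<close>. The claim is that every such linear functional,
  continuous or not, is a multiple of evaluation at \<open>r\<close>
  (\<open>invariant_functional_is_evaluation\<close>). As the automorphism group is transitive on vertices
  (\<open>vertex_transitive\<close>), the same multiple then serves at every vertex.

  To see that an invariant functional \<open>\<phi>\<close> kills a given \<open>x\<close>, without any continuity, one exhibits
  \<open>x\<close> as a finite linear combination of differences \<open>y - \<lambda>(g) y\<close> in \<open>\<ell>\<^sub>p\<close> with \<open>g\<close> fixing \<open>r\<close>.
  Let \<open>x\<close> be supported on infinitely many branches at \<open>r\<close>, with infinitely many others left over,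
  and spread it over a binary tree of disjoint copies, halving the values at each generation. The
  sum \<open>y\<close> of all the copies is in \<open>\<ell>\<^sub>p\<close>: generation \<open>k\<close> contributes \<open>2\<^sup>k\<close> copies of size
  \<open>2\<^sup>-\<^sup>k\<close>, and \<open>2\<^sup>k (2\<^sup>-\<^sup>k)\<^sup>p\<close> is summable for
  \<open>1 < p < \<infinity>\<close>, while for \<open>p = \<infinity>\<close> the sum is clearly bounded. If \<open>g\<close> and \<open>g'\<close> carry every copy to its two
  children, then \<open>y = x + (\<lambda>(g) y + \<lambda>(g') y) / 2\<close>, and therefore \<open>\<phi> x = 0\<close>
  (\<open>invariant_functional_vanishes_on_branches\<close>). Any \<open>x\<close> with \<open>x r = 0\<close> is a sum of two functions,
  each of which can be moved to such a position.

  The automorphisms come from identifying the tree with the tree of finite words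
  (\<open>word_coordinates\<close>), on which every permutation of the alphabet acts through the first letter.
\<close>

section \<open>Words as coordinates on the tree\<close>

definition nonbacktracking :: "('v \<Rightarrow> 'v \<Rightarrow> bool) \<Rightarrow> 'v list \<Rightarrow> bool" where
  "nonbacktracking E xs \<longleftrightarrow>
     successively E xs \<and> (\<forall>i. i + 2 < length xs \<longrightarrow> xs ! i \<noteq> xs ! (i + 2))"

lemma nonbacktracking_snoc:
  assumes "nonbacktracking E (xs @ [p, v])" "E v z" "z \<noteq> p"
  shows "nonbacktracking E (xs @ [p, v, z])"
proof -
  have "(xs @ [p, v, z]) ! i \<noteq> (xs @ [p, v, z]) ! (i + 2)"
    if i: "i + 2 < length (xs @ [p, v, z])" for i
  proof (cases "i + 2 < length (xs @ [p, v])")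
    case True
    have "(xs @ [p, v, z]) ! j = (xs @ [p, v]) ! j" if "j < length (xs @ [p, v])" for j
      using that nth_append[of "xs @ [p, v]" "[z]" j] by simp
    then show ?thesis using True assms(1) by (auto simp: nonbacktracking_def)
  next
    case False
    then have "i = length xs" using i by simp
    then show ?thesis using assms(3) by (auto simp: nth_append)
  qed
  then show ?thesis
    using assms(1,2) by (auto simp: nonbacktracking_def successively_append_iff)
qed

lemma nonbacktracking_rev:
  assumes "symp E" "nonbacktracking E xs"
  shows "nonbacktracking E (rev xs)"
proof -
  have "rev xs ! i \<noteq> rev xs ! (i + 2)" if "i + 2 < length xs" for i
  proof -
    define j where "j = length xs - Suc (i + 2)"
    have "j + 2 < length xs" "rev xs ! i = xs ! (j + 2)" "rev xs ! (i + 2) = xs ! j"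
      using that by (auto simp: j_def rev_nth intro!: arg_cong[of _ _ "(!) xs"])
    then show ?thesis using assms(2) unfolding nonbacktracking_def by metis
  qed
  moreover have "(\<lambda>x y. E y x) = (\<lambda>x y. E x y)"
    using assms(1) by (auto simp: fun_eq_iff symp_def)
  then have "successively (\<lambda>x y. E y x) xs = successively E xs"
    by (rule arg_cong[where f = "\<lambda>F. successively F xs"])
  ultimately show ?thesis using assms(2) by (simp add: nonbacktracking_def)
qed

lemma nonbacktracking_tl: "nonbacktracking E (x # xs) \<Longrightarrow> nonbacktracking E xs"
  by (auto simp: nonbacktracking_def successively_Cons)

lemma nonbacktracking_butlast: "nonbacktracking E xs \<Longrightarrow> nonbacktracking E (butlast xs)"
  by (auto simp: nonbacktracking_def successively_conv_nth nth_butlast)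

text \<open>
  In a shortest counterexample, dropping either end vertex leaves a path, so the only repetition is
  that the two ends coincide. Irreflexivity excludes length one, the nonbacktracking condition
  excludes length two, and a longer closed walk is a cycle.
\<close>
lemma nonbacktracking_imp_distinct:
  assumes "simple_graph E" "acyclic_graph E" "nonbacktracking E xs"
  shows "distinct xs"
  using assms(3)
proof (induction "length xs" arbitrary: xs rule: less_induct)
  case less
  show ?case
  proof (cases "length xs < 2")
    case True
    then show ?thesis by (cases xs) auto
  next
    case False
    then obtain a ys z where xs: "xs = a # ys @ [z]"
      by (metis One_nat_def Suc_1 append_butlast_last_id length_Cons less_Suc0 lessI list.exhaust
          list.size(3) not_less_iff_gr_or_eq zero_less_Suc less_Suc_eq)
    have d: "distinct (ys @ [z])" "distinct (a # ys)"
      using less.hyps[of "ys @ [z]"] less.hyps[of "a # ys"] nonbacktracking_tl[of E a "ys @ [z]"]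
        nonbacktracking_butlast[of E xs] less.prems
      by (auto simp: xs)
    have "a \<noteq> z"
    proof
      assume z: "a = z"
      have s: "successively E (a # ys @ [z])"
        using less.prems by (simp add: nonbacktracking_def xs)
      consider "ys = []" | b where "ys = [b]" | "length ys \<ge> 2"
        by (cases ys rule: remdups_adj.cases) auto
      then show False
      proof cases
        case 1
        then show False using s z assms(1) by (auto simp: simple_graph_def irreflp_def)
      next
        case 2
        then show False using less.prems z by (auto simp: nonbacktracking_def xs)
      next
        case 3
        then have "graph_cycle E (a # ys)"
          using s d z by (auto simp: graph_cycle_def successively_append_iff successively_Cons)
        then show False using assms(2) by (auto simp: acyclic_graph_def)
      qed
    qed
    then show ?thesis using d by (auto simp: xs)
  qed
qed

text \<open>
  A choice \<open>c p v\<close> of labels for the neighbours of \<open>v\<close> other than its parent \<open>p\<close> turns a word into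
  a walk away from \<open>p\<close>. The recursion has to remember the parent, hence the pair.
\<close>
definition descend :: "('v \<Rightarrow> 'v \<Rightarrow> 'i \<Rightarrow> 'v) \<Rightarrow> 'v \<Rightarrow> 'v \<Rightarrow> 'i list \<Rightarrow> 'v \<times> 'v" where
  "descend c p v u = foldl (\<lambda>(p, v) i. (v, c p v i)) (p, v) u"

lemma descend_simps [simp]:
  "descend c p v [] = (p, v)"
  "descend c p v (i # u) = descend c v (c p v i) u"
  "descend c p v (u @ [i]) =
     (snd (descend c p v u), case_prod c (descend c p v u) i)"
  by (auto simp: descend_def split: prod.splits)

fun descent_path :: "('v \<Rightarrow> 'v \<Rightarrow> 'i \<Rightarrow> 'v) \<Rightarrow> 'v \<Rightarrow> 'v \<Rightarrow> 'i list \<Rightarrow> 'v list" where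
  "descent_path c p v [] = [v]"
| "descent_path c p v (i # u) = v # descent_path c v (c p v i) u"

lemma descent_path_Cons: "\<exists>us. descent_path c p v u = v # us"
  by (cases u) auto

lemma last_descent_path: "last (descent_path c p v u) = snd (descend c p v u)"
proof (induction u arbitrary: p v)
  case (Cons i u)
  then show ?case using descent_path_Cons[of c v "c p v i" u] by auto
qed auto

lemma nonbacktracking_descent_path:
  assumes "\<And>p v i. E v (c p v i) \<and> c p v i \<noteq> p"
    and "nonbacktracking E (xs @ [p, v])"
  shows "nonbacktracking E (xs @ p # descent_path c p v u)"
  using assms(2)
proof (induction u arbitrary: xs p v)
  case (Cons i u)
  have "nonbacktracking E ((xs @ [p]) @ [v, c p v i])"
    using nonbacktracking_snoc[OF Cons.prems] assms(1) by simp
  from Cons.IH[OF this] show ?case by simp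
qed auto

text \<open>
  If two words first differ after a common prefix ending at \<open>v\<close>, the walk from the end of one
  back up to \<open>v\<close> and down to the end of the other never backtracks, so its ends differ.
\<close>
lemma descend_inj:
  assumes E: "simple_graph E" "acyclic_graph E"
    and c: "\<And>p v i. E v (c p v i) \<and> c p v i \<noteq> p" "\<And>p v. inj (c p v)"
    and eq: "snd (descend c p v u) = snd (descend c p v w)"
  shows "u = w"
proof -
  have edge: "nonbacktracking E [v, c p v i]" for p v i
    using c(1) by (simp add: nonbacktracking_def)
  have path: "nonbacktracking E (v # descent_path c v (c p v i) u)" for p v i u
    using nonbacktracking_descent_path[of E c "[]" v "c p v i" u] c(1) edge by simp
  have ne: "snd (descend c v (c p v i) u) \<noteq> v" for p v i u
    using nonbacktracking_imp_distinct[OF E path[of v p i u]]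
      last_descent_path[of c v "c p v i" u] descent_path_Cons[of c v "c p v i" u]
    by (metis distinct.simps(2) last_in_set list.distinct(1))
  have ne': "snd (descend c v (c p v i) u) \<noteq> snd (descend c v (c p v j) w)"
    if "i \<noteq> j" for p v i j u w
  proof -
    obtain us where us: "descent_path c v (c p v i) u = c p v i # us"
      using descent_path_Cons by metis
    have "nonbacktracking E (rev us @ [c p v i, v])"
      using nonbacktracking_rev[OF _ path[of v p i u]] E(1) us by (simp add: simple_graph_def)
    moreover have "c p v j \<noteq> c p v i"
      using c(2)[of p v] that by (auto simp: inj_eq)
    ultimately have "nonbacktracking E ((rev us @ [c p v i]) @ [v, c p v j])"
      using nonbacktracking_snoc[of E "rev us" "c p v i" v "c p v j"] c(1)[of v p j] by simp
    from nonbacktracking_descent_path[OF c(1) this]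
    have "nonbacktracking E (rev (c p v i # us) @ v # descent_path c v (c p v j) w)"
      by simp
    from nonbacktracking_imp_distinct[OF E this]
    have "set (descent_path c v (c p v i) u) \<inter> set (descent_path c v (c p v j) w) = {}"
      by (auto simp: us)
    moreover have "snd (descend c v (c p v i) u) \<in> set (descent_path c v (c p v i) u)" for i u
      using last_descent_path[of c v "c p v i" u] descent_path_Cons[of c v "c p v i" u]
      by (metis last_in_set list.distinct(1))
    ultimately show ?thesis by (metis disjoint_iff)
  qed
  show ?thesis using eq
  proof (induction u arbitrary: p v w)
    case Nil
    then show ?case using ne by (cases w) (metis descend_simps snd_conv)+
  next
    case (Cons i u)
    then show ?case
    proof (cases w)
      case Nil
      then show ?thesis using Cons.prems ne by (metis descend_simps(1,2) snd_conv)
    next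
      case (Cons j w')
      then show ?thesis using Cons.prems Cons.IH ne' by (metis descend_simps(2))
    qed
  qed
qed

text \<open>
  Every tree of this kind is the tree of words over any countably infinite alphabet, and any vertex
  may serve as the empty word. This supplies all the automorphisms that are needed below: a word
  tree visibly admits every permutation of the first letter.
\<close>
lemma word_coordinates:
  fixes E :: "'v \<Rightarrow> 'v \<Rightarrow> bool" and r :: 'v
  assumes T: "aleph0_regular_tree E" and inf: "infinite (UNIV :: 'i::countable set)"
  obtains h :: "'i::countable list \<Rightarrow> 'v" where "bij h" "h [] = r"
    "\<And>u w. E (h u) (h w) \<longleftrightarrow> (\<exists>i. w = u @ [i]) \<or> (\<exists>i. u = w @ [i])"
proof -
  have E: "simple_graph E" "acyclic_graph E" "connected_graph E"
    and sym: "E u w \<Longrightarrow> E w u" for u w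
    using T by (auto simp: aleph0_regular_tree_def simple_graph_def symp_def)
  have "\<exists>f :: 'i \<Rightarrow> 'v. bij_betw f UNIV ({w. E v w} - {p})" for p v
  proof -
    have "infinite ({w. E v w} - {p})" "countable ({w. E v w} - {p})"
      using T unfolding aleph0_regular_tree_def
      by (auto intro: countable_subset[OF subset_UNIV])
    then show ?thesis
      using bij_betw_trans[OF to_nat_on_infinite[OF _ inf] bij_betw_from_nat_into] by blast
  qed
  note someI_ex[OF this]
  then obtain c where c: "bij_betw (c p v :: 'i \<Rightarrow> 'v) UNIV ({w. E v w} - {p})" for p v
    by (rule that[of "\<lambda>p v. SOME f. bij_betw f UNIV ({w. E v w} - {p})"])
  have c1: "E v (c p v i) \<and> c p v i \<noteq> p" for p v i
    using c[of p v] by (auto simp: bij_betw_def)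
  have c2: "inj (c p v)" for p v using c by (auto simp: bij_betw_def)
  \<comment> \<open>The root has no parent. Taking \<open>r\<close> itself as its parent removes none of its neighbours,
    because \<open>E\<close> is irreflexive.\<close>
  define h where "h u = snd (descend c r r u)" for u
  have inj: "inj h"
    using descend_inj[OF E(1,2) c1 c2] by (auto simp: h_def inj_def)
  have child: "E (h u) (h (u @ [i]))" for u i
    using c1 by (auto simp: h_def split: prod.splits)
  have nbr: "(\<exists>i. t = h (u @ [i])) \<or> (\<exists>w i. u = w @ [i] \<and> t = h w)" if t: "E (h u) t" for u t
  proof (cases "t = fst (descend c r r u)")
    case True
    then show ?thesis
    proof (cases u rule: rev_cases)
      case Nil
      then show ?thesis using t True E(1) by (auto simp: h_def simple_graph_def irreflp_def)
    next
      case (snoc w i)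
      then show ?thesis using True by (auto simp: h_def)
    qed
  next
    case False
    then have "t \<in> range (c (fst (descend c r r u)) (h u))"
      using t c by (auto simp: bij_betw_def)
    then show ?thesis by (auto simp: h_def split: prod.splits)
  qed
  have "t \<in> range h" for t
  proof -
    have "E\<^sup>*\<^sup>* r t" using E(3) by (simp add: connected_graph_def)
    then show ?thesis
    proof (induction rule: rtranclp_induct)
      case base
      then show ?case by (metis h_def descend_simps(1) snd_conv rangeI)
    next
      case (step y z)
      then show ?case using nbr by blast
    qed
  qed
  then have "bij h" using inj by (auto simp: bij_def)
  moreover have "E (h u) (h w) \<longleftrightarrow> (\<exists>i. w = u @ [i]) \<or> (\<exists>i. u = w @ [i])" for u w
    using nbr[of u "h w"] child sym inj by (auto simp: inj_eq)
  moreover have "h [] = r" by (simp add: h_def)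
  ultimately show ?thesis using that by blast
qed

section \<open>Permuting the branches at the root\<close>

text \<open>
  This turns the child maps \<open>i \<mapsto> 2i\<close> and \<open>i \<mapsto> 2i + 1\<close> of a binary heap, which are injective but
  not surjective, into permutations.
\<close>
lemma extend_to_permutation:
  fixes f :: "'i::countable \<Rightarrow> 'i"
  assumes "inj_on f X" "infinite (- X)" "infinite (- (f ` X))"
  obtains \<pi> where "bij \<pi>" "\<And>i. i \<in> X \<Longrightarrow> \<pi> i = f i"
proof -
  define g where "g = from_nat_into (- (f ` X)) \<circ> to_nat_on (- X)"
  have g: "bij_betw g (- X) (- (f ` X))"
    unfolding g_def
    by (rule bij_betw_trans[OF to_nat_on_infinite bij_betw_from_nat_into]) (use assms in auto)
  define \<pi> where "\<pi> i = (if i \<in> X then f i else g i)" for i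
  have "bij_betw \<pi> X (f ` X)"
    using assms(1) by (auto simp: bij_betw_def \<pi>_def inj_on_def)
  moreover have "bij_betw \<pi> (- X) (- (f ` X)) \<longleftrightarrow> bij_betw g (- X) (- (f ` X))"
    by (rule bij_betw_cong) (simp add: \<pi>_def)
  ultimately have "bij_betw \<pi> (X \<union> - X) (f ` X \<union> - (f ` X))"
    using g by (intro bij_betw_combine) auto
  then have "bij \<pi>" by (simp only: Compl_partition)
  then show ?thesis using that by (simp add: \<pi>_def)
qed

fun map_head :: "('i \<Rightarrow> 'i) \<Rightarrow> 'i list \<Rightarrow> 'i list" where
  "map_head \<pi> [] = []"
| "map_head \<pi> (i # u) = \<pi> i # u"

lemma map_head_inverse:
  "bij \<pi> \<Longrightarrow> map_head (inv \<pi>) (map_head \<pi> u) = u"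
  "bij \<pi> \<Longrightarrow> map_head \<pi> (map_head (inv \<pi>) u) = u"
  by (cases u; simp add: bij_is_inj bij_is_surj surj_f_inv_f)+

lemma bij_map_head: "bij \<pi> \<Longrightarrow> bij (map_head \<pi>)"
  by (rule o_bij[of "map_head (inv \<pi>)"]) (auto simp: fun_eq_iff map_head_inverse)

text \<open>
  Acting on the first letter does not disturb the relation between a word and its one-letter
  extensions, which is adjacency in the coordinates.
\<close>
lemma map_head_eq_snoc_iff:
  assumes "inj \<pi>"
  shows "(\<exists>i. map_head \<pi> w = map_head \<pi> u @ [i]) \<longleftrightarrow> (\<exists>i. w = u @ [i])"
proof (cases u)
  case Nil
  then show ?thesis by (cases w) auto
next
  case (Cons j u')
  then show ?thesis using assms by (cases w) (auto simp: inj_eq)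
qed

text \<open>
  The branches at the root are labelled by first letters; each is carried rigidly, in the given
  coordinates, onto the branch with the permuted label.
\<close>
definition permute_branches :: "('i list \<Rightarrow> 'v) \<Rightarrow> ('i \<Rightarrow> 'i) \<Rightarrow> 'v \<Rightarrow> 'v" where
  "permute_branches h \<pi> t = h (map_head \<pi> (inv h t))"

lemma permute_branches_Aut:
  assumes h: "bij h" "\<And>u w. E (h u) (h w) \<longleftrightarrow> (\<exists>i. w = u @ [i]) \<or> (\<exists>i. u = w @ [i])"
    and \<pi>: "bij \<pi>"
  shows "permute_branches h \<pi> \<in> graph_Aut E"
proof -
  have "permute_branches h \<pi> = h \<circ> map_head \<pi> \<circ> inv h"
    by (auto simp: permute_branches_def)
  then have "bij (permute_branches h \<pi>)"
    using h(1) bij_map_head[OF \<pi>] by (simp add: bij_comp bij_imp_bij_inv)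
  moreover have "E (permute_branches h \<pi> s) (permute_branches h \<pi> t) \<longleftrightarrow> E s t" for s t
  proof -
    obtain u w where "s = h u" "t = h w" using h(1) by (metis bij_is_surj surjD)
    then show ?thesis
      using h(1) \<pi> by (simp add: permute_branches_def bij_is_inj h(2) map_head_eq_snoc_iff)
  qed
  ultimately show ?thesis by (simp add: graph_Aut_def)
qed

lemma translation_permute_branches:
  assumes "bij h" "bij \<pi>"
  shows "translation (permute_branches h \<pi>) x (h u) = x (h (map_head (inv \<pi>) u))"
proof -
  have "permute_branches h \<pi> = h \<circ> map_head \<pi> \<circ> inv h"
    by (auto simp: permute_branches_def)
  then have "inj (permute_branches h \<pi>)"
    using assms(1) bij_map_head[OF assms(2)] by (simp add: bij_comp bij_imp_bij_inv bij_is_inj)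
  moreover have "permute_branches h \<pi> (h (map_head (inv \<pi>) u)) = h u"
    using assms by (simp add: permute_branches_def bij_is_inj map_head_inverse)
  ultimately have "inv (permute_branches h \<pi>) (h u) = h (map_head (inv \<pi>) u)"
    by (rule inv_f_eq)
  then show ?thesis by (simp add: translation_def)
qed

lemma vertex_transitive:
  assumes T: "aleph0_regular_tree E"
  obtains g where "g \<in> graph_Aut E" "g r = t"
proof -
  have inf: "infinite (UNIV :: nat set)" by simp
  obtain h :: "nat list \<Rightarrow> _" where h: "bij h" "h [] = r"
    "\<And>u w. E (h u) (h w) \<longleftrightarrow> (\<exists>i. w = u @ [i]) \<or> (\<exists>i. u = w @ [i])"
    by (rule word_coordinates[OF T inf, of r]) (rule that)
  obtain k :: "nat list \<Rightarrow> _" where k: "bij k" "k [] = t"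
    "\<And>u w. E (k u) (k w) \<longleftrightarrow> (\<exists>i. w = u @ [i]) \<or> (\<exists>i. u = w @ [i])"
    by (rule word_coordinates[OF T inf, of t]) (rule that)
  have "E (k (inv h a)) (k (inv h b)) \<longleftrightarrow> E a b" for a b
  proof -
    obtain u w where "a = h u" "b = h w" using h(1) by (metis bij_is_surj surjD)
    then show ?thesis using h(1) by (simp add: bij_is_inj h(3) k(3))
  qed
  then have "k \<circ> inv h \<in> graph_Aut E"
    using h(1) k(1) by (simp add: graph_Aut_def bij_comp bij_imp_bij_inv)
  moreover have "(k \<circ> inv h) r = t"
    using h(1,2) k(2) by (simp add: bij_is_inj inv_f_eq)
  ultimately show ?thesis using that by blast
qed

section \<open>The sequence spaces\<close>

lemma ell_dominated:
  assumes "1 < p" "x \<in> ell p" "\<And>t. norm (y t) \<le> norm (x t)"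
  shows "y \<in> ell p"
proof (cases "p = \<infinity>")
  case True
  then obtain B where "\<And>t. norm (x t) \<le> B"
    using assms(2) by (auto simp: ell_def bounded_iff)
  then have "norm (y t) \<le> B" for t using assms(3) order_trans by blast
  then show ?thesis using True by (auto simp: ell_def bounded_iff)
next
  case False
  have q: "0 \<le> real_of_ereal p" using assms(1) by (cases p) auto
  have "(\<lambda>t. norm (y t) powr real_of_ereal p) summable_on UNIV"
    by (rule summable_on_comparison_test[where f = "\<lambda>t. norm (x t) powr real_of_ereal p"])
      (use assms False q in \<open>auto simp: ell_def intro!: powr_mono2\<close>)
  then show ?thesis using False by (simp add: ell_def)
qed

lemma ell_scale:
  assumes "x \<in> ell p"
  shows "(\<lambda>t. c * x t) \<in> ell p"
proof (cases "p = \<infinity>")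
  case True
  then have "bounded ((\<lambda>z. c * z) ` range x)"
    using assms by (intro bounded_linear_image bounded_linear_mult_right) (auto simp: ell_def)
  then show ?thesis using True by (simp add: ell_def image_image)
next
  case False
  then show ?thesis
    using assms by (auto simp: ell_def norm_mult powr_mult intro!: summable_on_cmult_right)
qed

lemma ell_translation:
  assumes "bij g" "x \<in> ell p"
  shows "translation g x \<in> ell p"
proof (cases "p = \<infinity>")
  case True
  have "range (translation g x) \<subseteq> range x" by (auto simp: translation_def)
  then show ?thesis using True assms(2) bounded_subset by (auto simp: ell_def)
next
  case False
  have "bij_betw (inv g) UNIV UNIV" using assms(1) by (rule bij_imp_bij_inv)
  from summable_on_reindex_bij_betw[OF this, of "\<lambda>t. norm (x t) powr real_of_ereal p"]
  show ?thesis using False assms(2) by (simp add: ell_def translation_def)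
qed

text \<open>
  Label the nodes of the infinite binary tree by positive integers, with children \<open>2n\<close> and \<open>2n + 1\<close>
  of \<open>n\<close>. The unit mass at the node \<open>1\<close>, halved at each generation, has value
  \<open>2\<^sup>-\<^sup>k\<close> at each of the \<open>2\<^sup>k\<close> nodes of generation \<open>k\<close>. Thus the weights are of order \<open>1 / n\<close>; their
  \<open>q\<close>-th powers are summable exactly when \<open>q > 1\<close>. The value at \<open>0\<close>, which is not a node, is zero.
\<close>
fun heap_weight :: "nat \<Rightarrow> real" where
  "heap_weight n = (if n = 0 then 0 else if n = 1 then 1 else heap_weight (n div 2) / 2)"

text \<open>The unconditional recursion equation would send the simplifier into a loop.\<close>
declare heap_weight.simps [simp del]

lemma heap_weight_0 [simp]: "heap_weight 0 = 0"
  and heap_weight_1 [simp]: "heap_weight (Suc 0) = 1"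
  and heap_weight_step: "2 \<le> n \<Longrightarrow> heap_weight n = heap_weight (n div 2) / 2"
  by (subst heap_weight.simps, simp)+

lemma heap_weight_bounds: "0 \<le> heap_weight n" "heap_weight n \<le> 2 / (real n + 1)"
proof (induction n rule: heap_weight.induct)
  case (1 n)
  {
    case 1
    then show ?case using "1.IH" heap_weight_step[of n] by (cases "n < 2") (auto simp: less_2_cases_iff)
  next
    case 2
    show ?case
    proof (cases "n < 2")
      case True
      then show ?thesis by (auto simp: less_2_cases_iff)
    next
      case False
      have "heap_weight n = heap_weight (n div 2) / 2" using False heap_weight_step by simp
      also have "\<dots> \<le> 1 / (real (n div 2) + 1)" using "1.IH"(2) False by simp
      also have "\<dots> \<le> 1 / ((real n + 1) / 2)"
      proof (rule divide_left_mono)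
        have "n \<le> 2 * (n div 2) + 1" by linarith
        then have "real n \<le> 2 * real (n div 2) + 1" by linarith
        then show "(real n + 1) / 2 \<le> real (n div 2) + 1" by simp
      qed auto
      finally show ?thesis by simp
    qed
  }
qed

lemma summable_heap_weight_powr:
  assumes "1 < q"
  shows "(\<lambda>n. heap_weight n powr q) summable_on UNIV"
proof -
  have "summable (\<lambda>n. real n powr (- q))"
    using assms by (simp add: summable_real_powr_iff)
  then have "summable (\<lambda>n. 2 powr q * real (Suc n) powr (- q))"
    by (intro summable_mult) (subst summable_Suc_iff, simp)
  then have s: "(\<lambda>n. 2 powr q * real (Suc n) powr (- q)) summable_on UNIV"
    by (subst summable_on_UNIV_nonneg_real_iff) auto
  show ?thesis
  proof (rule summable_on_comparison_test[OF s])
    fix n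
    have "heap_weight n powr q \<le> (2 / (real n + 1)) powr q"
      using heap_weight_bounds assms by (intro powr_mono2) auto
    also have "\<dots> = 2 powr q * real (Suc n) powr (- q)"
      by (simp add: powr_divide powr_minus_divide add.commute)
    finally show "heap_weight n powr q \<le> 2 powr q * real (Suc n) powr (- q)" .
  qed auto
qed

text \<open>
  Here \<open>f\<close> parametrizes the part of \<open>x\<close> that is copied and \<open>g (n, _)\<close> the place of the \<open>n\<close>-th copy.
  As the copies are disjoint, the \<open>q\<close>-th power sum of \<open>y\<close> is the product of that of the weights and
  that of the copied part, where \<open>q\<close> is a finite exponent \<open>p\<close>. For \<open>p = \<infinity>\<close> bounded weights suffice.
\<close>
lemma ell_weighted_copies:
  fixes f :: "'b \<Rightarrow> 'v" and g :: "nat \<times> 'b \<Rightarrow> 'v"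
  assumes p: "1 < p" and x: "x \<in> ell p" and inj: "inj f" "inj g"
    and off: "\<And>t. t \<notin> range g \<Longrightarrow> y t = 0"
    and on: "\<And>n b. y (g (n, b)) = of_real (heap_weight n) * x (f b)"
  shows "y \<in> ell p"
proof (cases "p = \<infinity>")
  case True
  then obtain B where B: "\<And>t. norm (x t) \<le> B"
    using x by (auto simp: ell_def bounded_iff)
  have "norm (y t) \<le> 2 * \<bar>B\<bar>" for t
  proof (cases "t \<in> range g")
    case True
    then obtain n b where t: "t = g (n, b)" by auto
    have "heap_weight n \<le> 2"
      using heap_weight_bounds(2)[of n] by (rule order_trans) (simp add: field_simps)
    moreover have "norm (x (f b)) \<le> \<bar>B\<bar>" using B[of "f b"] by linarith
    ultimately show ?thesis
      using heap_weight_bounds(1)[of n] by (auto simp: t on norm_mult intro!: mult_mono)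
  qed (simp add: off)
  then show ?thesis using True by (auto simp: ell_def bounded_iff)
next
  case False
  define q where "q = real_of_ereal p"
  have q: "1 < q" using p False by (cases p) (auto simp: q_def)
  have "(\<lambda>t. norm (x t) powr q) summable_on UNIV"
    using x False by (simp add: ell_def q_def)
  then have "(\<lambda>t. norm (x t) powr q) summable_on range f"
    by (rule summable_on_subset) auto
  then have sx: "(\<lambda>b. norm (x (f b)) powr q) summable_on UNIV"
    using summable_on_reindex[OF inj(1), of "\<lambda>t. norm (x t) powr q"] by (simp add: comp_def)
  have "(\<lambda>nb. norm (y (g nb)) powr q) summable_on (UNIV \<times> UNIV)"
  proof (rule summable_on_SigmaI)
    show "((\<lambda>b. norm (y (g (n, b))) powr q) has_sum
        (heap_weight n powr q * infsum (\<lambda>b. norm (x (f b)) powr q) UNIV)) UNIV" for n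
      using has_sum_cmult_right[OF has_sum_infsum[OF sx], of "heap_weight n powr q"]
        heap_weight_bounds(1)[of n]
      by (simp add: on norm_mult powr_mult)
    show "(\<lambda>n. heap_weight n powr q * infsum (\<lambda>b. norm (x (f b)) powr q) UNIV) summable_on UNIV"
      using summable_heap_weight_powr[OF q] by (rule summable_on_cmult_left)
  qed auto
  then have "(\<lambda>t. norm (y t) powr q) summable_on range g"
    using summable_on_reindex[OF inj(2), of "\<lambda>t. norm (y t) powr q"] by (simp add: comp_def)
  moreover have "(\<lambda>t. norm (y t) powr q) summable_on range g \<longleftrightarrow>
      (\<lambda>t. norm (y t) powr q) summable_on UNIV"
    by (rule summable_on_cong_neutral) (auto simp: off)
  ultimately show ?thesis using False by (simp add: ell_def q_def)
qed

lemma ell_indicator: "(\<lambda>t. if t = r then 1 else 0) \<in> ell p"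
proof (cases "p = \<infinity>")
  case True
  have "norm (if t = r then 1 else 0 :: complex) \<le> 1" for t by simp
  then show ?thesis using True unfolding ell_def bounded_iff by (auto intro!: exI[of _ 1])
next
  case False
  have "(\<lambda>t. norm (if t = r then 1 else 0 :: complex) powr real_of_ereal p) summable_on UNIV"
    by (rule finite_nonzero_values_imp_summable_on, rule finite_subset[of _ "{r}"]) auto
  then show ?thesis using False by (simp add: ell_def)
qed

section \<open>Invariant functionals and the commutant\<close>

text \<open>
  The heart of the argument. With first letters \<open>(j, a)\<close>, let \<open>x\<close> live on the branches with \<open>j = 1\<close>.
  Two automorphisms send the branch \<open>(j, a)\<close> with \<open>j \<ge> 1\<close> to \<open>(2j, a)\<close> and \<open>(2j + 1, a)\<close>. Let \<open>y\<close> be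
  the sum of copies of \<open>x\<close> on all heap nodes \<open>j\<close>, with the heap weights. The average of the two
  translates of \<open>y\<close> is \<open>y\<close> without its copy at node \<open>1\<close>, that is \<open>y - x\<close>. Invariance gives
  \<open>\<phi> (y - x) = \<phi> y\<close>, so \<open>\<phi> x = 0\<close>. This is where \<open>p > 1\<close> enters: the function \<open>y\<close> has to be in
  \<open>\<ell>\<^sub>p\<close>. For \<open>p = 1\<close> the sum of all values is an invariant functional that does not vanish.

  The letters with \<open>j = 0\<close> are not part of the heap. They leave the room needed to complete the
  two child maps to permutations.
\<close>
lemma invariant_functional_vanishes_on_branches:
  fixes \<phi> :: "('v \<Rightarrow> complex) \<Rightarrow> complex" and h :: "(nat \<times> nat) list \<Rightarrow> 'v"
  assumes p: "1 < p" and h: "bij h"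
    and add: "\<And>x y. x \<in> ell p \<Longrightarrow> y \<in> ell p \<Longrightarrow> \<phi> (\<lambda>t. x t + y t) = \<phi> x + \<phi> y"
    and scale: "\<And>c x. x \<in> ell p \<Longrightarrow> \<phi> (\<lambda>t. c * x t) = c * \<phi> x"
    and inv: "\<And>\<pi> x. bij \<pi> \<Longrightarrow> x \<in> ell p \<Longrightarrow> \<phi> (translation (permute_branches h \<pi>) x) = \<phi> x"
    and x: "x \<in> ell p"
    and supp: "x (h []) = 0" "\<And>j a u. j \<noteq> 1 \<Longrightarrow> x (h ((j, a) # u)) = 0"
  shows "\<phi> x = 0"
proof -
  define y where "y t = (case inv h t of [] \<Rightarrow> 0
      | (j, a) # u \<Rightarrow> of_real (heap_weight j) * x (h ((1, a) # u)))" for t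
  have y_Nil: "y (h []) = 0"
    and y_Cons: "y (h ((j, a) # u)) = of_real (heap_weight j) * x (h ((1, a) # u))" for j a u
    using h by (simp_all add: y_def bij_is_inj)
  have y: "y \<in> ell p"
  proof (rule ell_weighted_copies[OF p x])
    show "inj (\<lambda>(a, u). h ((1, a) # u))" "inj (\<lambda>(j, a, u). h ((j, a) # u))"
      using bij_is_inj[OF h] by (auto simp: inj_def)
    show "y t = 0" if "t \<notin> range (\<lambda>(j, a, u). h ((j, a) # u))" for t
    proof -
      obtain v where v: "t = h v" using h by (metis bij_is_surj surjD)
      have "v = []"
      proof (rule ccontr)
        assume "v \<noteq> []"
        then obtain j a u where "v = (j, a) # u" by (metis list.exhaust surj_pair)
        then have "t = (\<lambda>(j, a, u). h ((j, a) # u)) (j, a, u)" using v by simp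
        then show False using that by (metis rangeI)
      qed
      then show ?thesis using y_Nil v by simp
    qed
    show "y ((\<lambda>(j, a, u). h ((j, a) # u)) (n, b)) =
        of_real (heap_weight n) * x ((\<lambda>(a, u). h ((1, a) # u)) b)" for n b
      by (cases b) (simp add: y_Cons)
  qed

  have "\<exists>\<pi> :: nat \<times> nat \<Rightarrow> nat \<times> nat. bij \<pi> \<and> (\<forall>i a. 1 \<le> i \<longrightarrow> \<pi> (i, a) = (2 * i + d, a))" for d
  proof -
    let ?f = "\<lambda>(i, a). (2 * i + d, a) :: nat \<times> nat" and ?X = "{1..} \<times> UNIV :: (nat \<times> nat) set"
    have "inj_on ?f ?X" by (auto simp: inj_on_def)
    moreover have inf: "infinite ({0 :: nat} \<times> (UNIV :: nat set))"
      by (simp add: finite_cartesian_product_iff)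
    have "infinite (- ?X)" "infinite (- (?f ` ?X))"
      by (rule infinite_super[OF _ inf], force)+
    ultimately obtain \<pi> where "bij \<pi>" "\<And>i. i \<in> ?X \<Longrightarrow> \<pi> i = ?f i"
      by (rule extend_to_permutation) (rule that)
    then show ?thesis by auto
  qed
  then obtain \<pi> :: "nat \<Rightarrow> nat \<times> nat \<Rightarrow> nat \<times> nat"
    where \<pi>: "\<And>d. bij (\<pi> d)" "\<And>d i a. 1 \<le> i \<Longrightarrow> \<pi> d (i, a) = (2 * i + d, a)"
    by metis
  define z where "z d = translation (permute_branches h (\<pi> d)) y" for d
  have z_Nil: "z d (h []) = 0" for d
    by (simp add: z_def translation_permute_branches[OF h \<pi>(1)] y_Nil)
  \<comment> \<open>A letter whose preimage under \<open>\<pi> d\<close> lies outside the heap contributes nothing, since \<open>y\<close>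
    vanishes there; so it does not matter how the child maps were completed.\<close>
  have z_Cons: "z d (h ((j, a) # u)) =
      (if 2 \<le> j \<and> j mod 2 = d then of_real (heap_weight (j div 2)) * x (h ((1, a) # u)) else 0)"
    if d: "d < 2" for d j a u
  proof -
    obtain i b where ib: "Hilbert_Choice.inv (\<pi> d) (j, a) = (i, b)" by fastforce
    then have \<pi>ib: "\<pi> d (i, b) = (j, a)"
      using \<pi>(1)[of d] by (metis bij_inv_eq_iff)
    have zy: "z d (h ((j, a) # u)) = of_real (heap_weight i) * x (h ((1, b) # u))"
      by (simp add: z_def translation_permute_branches[OF h \<pi>(1)] ib y_Cons)
    show ?thesis
    proof (cases "2 \<le> j \<and> j mod 2 = d")
      case True
      then have "\<pi> d (j div 2, a) = (j, a)" using \<pi>(2)[of "j div 2" d a] by auto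
      then have "(i, b) = (j div 2, a)"
        using \<pi>ib bij_is_inj[OF \<pi>(1)[of d]] by (metis injD)
      then show ?thesis using zy True by simp
    next
      case False
      have "i = 0"
      proof (rule ccontr)
        assume "i \<noteq> 0"
        then have "j = 2 * i + d" using \<pi>(2)[of i d b] \<pi>ib by auto
        then show False using False d \<open>i \<noteq> 0\<close> by auto
      qed
      then show ?thesis using zy False by auto
    qed
  qed
  define w where "w t = 1 / 2 * z 0 t + 1 / 2 * z 1 t" for t
  have split: "y t = x t + w t \<and> norm (w t) \<le> norm (y t)" for t
  proof -
    obtain v where v: "t = h v" using h by (metis bij_is_surj surjD)
    show ?thesis
    proof (cases v)
      case Nil
      then show ?thesis by (simp add: v w_def z_Nil y_Nil supp)
    next
      case (Cons k u)
      obtain j a where k: "k = (j, a)" by fastforce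
      consider "j = 0" | "j = 1" | "2 \<le> j" by linarith
      then show ?thesis
      proof cases
        case 3
        have "w t = y t"
          using 3 by (cases "even j")
            (auto simp: v Cons k w_def z_Cons y_Cons heap_weight_step[OF 3] odd_iff_mod_2_eq_one)
        then show ?thesis using 3 supp by (simp add: v Cons k)
      qed (simp_all add: v Cons k w_def z_Cons y_Cons supp)
    qed
  qed
  have z: "z d \<in> ell p" "\<phi> (z d) = \<phi> y" for d
  proof -
    have "bij (permute_branches h (\<pi> d))"
      unfolding permute_branches_def[abs_def]
      using bij_comp[OF bij_comp[OF bij_imp_bij_inv[OF h] bij_map_head[OF \<pi>(1)]] h]
      by (simp add: comp_def)
    then show "z d \<in> ell p" unfolding z_def using y by (rule ell_translation)
    show "\<phi> (z d) = \<phi> y" unfolding z_def using \<pi>(1) y by (rule inv)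
  qed
  have "w \<in> ell p" using ell_dominated[OF p y] split by blast
  moreover have "y = (\<lambda>t. x t + w t)" using split by auto
  ultimately have "\<phi> y = \<phi> x + \<phi> w" using add x by metis
  also have "\<phi> w = 1 / 2 * \<phi> (z 0) + 1 / 2 * \<phi> (z 1)"
    unfolding w_def[abs_def] using add scale ell_scale z by metis
  finally show ?thesis using z by simp
qed

text \<open>
  Split \<open>x\<close> into its value at \<open>r\<close>, the part on the branches with label in the set \<open>A\<close> of pairs
  \<open>(1, a)\<close>, and the rest. The preceding lemma kills the part on \<open>A\<close>. Since \<open>A\<close> and
  its complement are both infinite, some permutation of the branches moves the rest into \<open>A\<close>, and
  so the rest is killed as well.
\<close>
lemma invariant_functional_is_evaluation:
  fixes \<phi> :: "('v \<Rightarrow> complex) \<Rightarrow> complex" and E :: "'v \<Rightarrow> 'v \<Rightarrow> bool"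
  assumes T: "aleph0_regular_tree E" and p: "1 < p"
    and add: "\<And>x y. x \<in> ell p \<Longrightarrow> y \<in> ell p \<Longrightarrow> \<phi> (\<lambda>t. x t + y t) = \<phi> x + \<phi> y"
    and scale: "\<And>c x. x \<in> ell p \<Longrightarrow> \<phi> (\<lambda>t. c * x t) = c * \<phi> x"
    and inv: "\<And>g x. g \<in> graph_Aut E \<Longrightarrow> g r = r \<Longrightarrow> x \<in> ell p \<Longrightarrow> \<phi> (translation g x) = \<phi> x"
    and x: "x \<in> ell p"
  shows "\<phi> x = \<phi> (\<lambda>t. if t = r then 1 else 0) * x r"
proof -
  have "infinite (UNIV :: (nat \<times> nat) set)" by (simp add: finite_prod)
  then obtain h :: "(nat \<times> nat) list \<Rightarrow> 'v" where h: "bij h" "h [] = r"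
    "\<And>u w. E (h u) (h w) \<longleftrightarrow> (\<exists>i. w = u @ [i]) \<or> (\<exists>i. u = w @ [i])"
    by (rule word_coordinates[OF T, of r]) (rule that)
  have inv': "\<phi> (translation (permute_branches h \<pi>) x) = \<phi> x" if "bij \<pi>" "x \<in> ell p" for \<pi> x
  proof (rule inv)
    show "permute_branches h \<pi> r = r"
      using h by (metis permute_branches_def bij_is_inj inv_f_eq map_head.simps(1))
  qed (use permute_branches_Aut[OF h(1,3)] that in auto)
  have vanish: "\<phi> y = 0"
    if "y \<in> ell p" "y (h []) = 0" "\<And>j a u. j \<noteq> 1 \<Longrightarrow> y (h ((j, a) # u)) = 0" for y
    by (rule invariant_functional_vanishes_on_branches[OF p h(1)]) (fact add scale inv' that)+

  define A where "A = {1 :: nat} \<times> (UNIV :: nat set)"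
  define restr where "restr P t = (case inv h t of [] \<Rightarrow> 0 | i # u \<Rightarrow> if P i then x t else 0)" for P t
  have restr_Nil: "restr P (h []) = 0"
    and restr_Cons: "restr P (h (i # u)) = (if P i then x (h (i # u)) else 0)" for P i u
    by (simp_all add: restr_def inv_f_f[OF bij_is_inj[OF h(1)]])
  have restr: "restr P \<in> ell p" for P
    by (rule ell_dominated[OF p x]) (auto simp: restr_def split: list.splits)

  have "\<phi> (restr (\<lambda>i. i \<in> A)) = 0"
    by (rule vanish[OF restr]) (auto simp: restr_Nil restr_Cons A_def)
  moreover have "\<phi> (restr (\<lambda>i. i \<notin> A)) = 0"
  proof -
    have infA: "infinite A" by (simp add: A_def finite_cartesian_product_iff)
    have "infinite ({0 :: nat} \<times> (UNIV :: nat set))" by (simp add: finite_cartesian_product_iff)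
    then have infB: "infinite (- A)" by (rule infinite_super[rotated]) (auto simp: A_def)
    define f where "f = from_nat_into A \<circ> to_nat_on (- A)"
    have f: "bij_betw f (- A) A"
      unfolding f_def
      by (rule bij_betw_trans[OF to_nat_on_infinite bij_betw_from_nat_into]) (use infA infB in auto)
    \<comment> \<open>The rest of \<open>x\<close> vanishes on \<open>A\<close>, so it is enough that the complement of \<open>A\<close> lands in \<open>A\<close>.\<close>
    obtain \<pi> where \<pi>: "bij \<pi>" "\<And>i. i \<in> - A \<Longrightarrow> \<pi> i = f i"
      using extend_to_permutation[of f "- A"] f infA infB by (auto simp: bij_betw_def)
    let ?y = "translation (permute_branches h \<pi>) (restr (\<lambda>i. i \<notin> A))"
    have y: "?y (h u) = restr (\<lambda>i. i \<notin> A) (h (map_head (Hilbert_Choice.inv \<pi>) u))" for u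
      by (rule translation_permute_branches[OF h(1) \<pi>(1)])
    have "?y \<in> ell p"
      using permute_branches_Aut[OF h(1,3) \<pi>(1)] restr
      by (intro ell_translation) (auto simp: graph_Aut_def)
    moreover have "?y (h ((j, a) # u)) = 0" if "j \<noteq> 1" for j a u
    proof -
      have "Hilbert_Choice.inv \<pi> (j, a) \<in> A"
      proof (rule ccontr)
        assume n: "Hilbert_Choice.inv \<pi> (j, a) \<notin> A"
        then have "\<pi> (Hilbert_Choice.inv \<pi> (j, a)) \<in> A"
          using \<pi>(2) f by (auto simp: bij_betw_def)
        then show False using that \<pi>(1) by (simp add: bij_is_surj surj_f_inv_f A_def)
      qed
      then show ?thesis by (simp add: y restr_Cons)
    qed
    moreover have "?y (h []) = 0" by (simp add: y restr_Nil)
    ultimately have "\<phi> ?y = 0" by (intro vanish)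
    then show ?thesis using inv'[OF \<pi>(1) restr] by simp
  qed
  ultimately have zero: "\<phi> (\<lambda>t. restr (\<lambda>i. i \<in> A) t + restr (\<lambda>i. i \<notin> A) t) = 0"
    using add restr by simp
  let ?\<delta> = "\<lambda>t. if t = r then 1 else 0 :: complex"
  have dec: "x t = x r * ?\<delta> t + (restr (\<lambda>i. i \<in> A) t + restr (\<lambda>i. i \<notin> A) t)" for t
  proof -
    obtain v where v: "t = h v" using h(1) by (metis bij_is_surj surjD)
    have "h (i # u) \<noteq> r" for i u using h by (metis bij_is_inj inj_eq list.distinct(1))
    then show ?thesis using v h(2) by (cases v) (auto simp: restr_Nil restr_Cons)
  qed
  have "(\<lambda>t. restr (\<lambda>i. i \<in> A) t + restr (\<lambda>i. i \<notin> A) t) \<in> ell p"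
    by (rule ell_dominated[OF p x]) (auto simp: restr_def split: list.splits)
  then have "\<phi> (\<lambda>t. x r * ?\<delta> t + (restr (\<lambda>i. i \<in> A) t + restr (\<lambda>i. i \<notin> A) t)) =
      \<phi> (\<lambda>t. x r * ?\<delta> t) + \<phi> (\<lambda>t. restr (\<lambda>i. i \<in> A) t + restr (\<lambda>i. i \<notin> A) t)"
    by (rule add[OF ell_scale[OF ell_indicator]])
  then have "\<phi> x = \<phi> (\<lambda>t. x r * ?\<delta> t)"
    unfolding dec[symmetric] zero by simp
  also have "\<dots> = x r * \<phi> ?\<delta>" by (rule scale[OF ell_indicator])
  finally show ?thesis by simp
qed

theorem theorem5:
  fixes E :: "'v \<Rightarrow> 'v \<Rightarrow> bool"
    and p :: ereal
    and S :: "('v \<Rightarrow> complex) \<Rightarrow> ('v \<Rightarrow> complex)"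
  assumes "aleph0_regular_tree E"
    and "1 < p" and "p \<le> \<infinity>"
    and "linear_operator_on (ell p) S"
  shows "(\<forall>g\<in>graph_Aut E. \<forall>x\<in>ell p. S (translation g x) = translation g (S x))
     \<longleftrightarrow> (\<exists>\<alpha>. \<forall>x\<in>ell p. S x = (\<lambda>t. \<alpha> * x t))"
proof
  assume comm: "\<forall>g\<in>graph_Aut E. \<forall>x\<in>ell p. S (translation g x) = translation g (S x)"
  obtain r :: 'v where True by simp
  define \<alpha> where "\<alpha> = S (\<lambda>t. if t = r then 1 else 0) r"
  have at_root: "S x r = \<alpha> * x r" if x: "x \<in> ell p" for x
    unfolding \<alpha>_def
  proof (rule invariant_functional_is_evaluation[OF assms(1,2), where \<phi> = "\<lambda>x. S x r"])
    fix g and y :: "'v \<Rightarrow> complex"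
    assume g: "g \<in> graph_Aut E" "g r = r" and y: "y \<in> ell p"
    have "inv g r = r" using g by (simp add: graph_Aut_def bij_is_inj inv_f_eq)
    then show "S (translation g y) r = S y r" using comm g(1) y by (simp add: translation_def)
  qed (use assms(4) x in \<open>simp_all add: linear_operator_on_def\<close>)
  have "S x t = \<alpha> * x t" if x: "x \<in> ell p" for x t
  proof -
    obtain g where g: "g \<in> graph_Aut E" "g t = r"
      using vertex_transitive[OF assms(1)] by metis
    have "translation g x \<in> ell p"
      using g(1) x by (simp add: graph_Aut_def ell_translation)
    from at_root[OF this] have "translation g (S x) r = \<alpha> * translation g x r"
      using comm g(1) x by simp
    moreover have "inv g r = t" using g by (simp add: graph_Aut_def bij_is_inj inv_f_eq)
    ultimately show ?thesis by (simp add: translation_def)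
  qed
  then show "\<exists>\<alpha>. \<forall>x\<in>ell p. S x = (\<lambda>t. \<alpha> * x t)" by blast
next
  assume "\<exists>\<alpha>. \<forall>x\<in>ell p. S x = (\<lambda>t. \<alpha> * x t)"
  then obtain \<alpha> where S: "\<And>x. x \<in> ell p \<Longrightarrow> S x = (\<lambda>t. \<alpha> * x t)" by blast
  show "\<forall>g\<in>graph_Aut E. \<forall>x\<in>ell p. S (translation g x) = translation g (S x)"
  proof (intro ballI)
    fix g and x :: "'v \<Rightarrow> complex"
    assume "g \<in> graph_Aut E" "x \<in> ell p"
    then show "S (translation g x) = translation g (S x)"
      by (simp add: S graph_Aut_def ell_translation) (simp add: translation_def)
  qed
qed

end
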